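(* Let $n,p\ge 1$ be integers with $2p\le n$, let $\ell\ge 0$, and let $\varepsilon$ be the unit roundoff. Let $U^{(\ell)}\in\mathbb{R}^{n\times n}$ be the exact orthogonal matrix of accumulated transformations after $\ell$ stages of the parallel trigonometric Jacobi algorithm with $p$ processes, i.e. $U^{(0)}=I$ and $U^{(m)}=U^{(m-1)}Q^{(m)}$ for $m=1,\dots,\ell$, where $Q^{(m)}$ is the exact orthogonal matrix consisting of the $p$ independent plane rotations of stage $m$. Let $\widetilde U^{(\ell)}$ be the corresponding matrix computed in floating-point arithmetic, i.e. $\widetilde U^{(0)}=I$ and $\widetilde U^{(m)}=\mathrm{fl}(\widetilde U^{(m-1)}\widetilde Q^{(m)})$ for $m=1,\dots,\ell$, where $\widetilde Q^{(m)}$ is the computed version of $Q^{(m)}$. Then $$\|\widetilde U^{(\ell)}-U^{(\ell)}\|_2\le\sum_{m=1}^{\ell}\|\delta U^{(m)}\|_2,$$ where $\delta U^{(m)}$ is the perturbation matrix of stage $m$, defined by $\widetilde U^{(m)}=\widetilde U^{(m-1)}Q^{(m)}+\delta U^{(m)}$. Moreover, if for every rotation used in the algorithm the computed cosine $\tilde c=(1+\varepsilon_c)c$ and the computed sine $\tilde s=(1+\varepsilon_s)s$ satisfy $$|\varepsilon_c|\le\frac{5\varepsilon}{1-5\varepsilon},\qquad |\varepsilon_s|\le\frac{5\varepsilon}{1-5\varepsilon},$$ then $$\|\widetilde U^{(\ell)}-U^{(\ell)}\|_2\le 14\,\varepsilon\,\ell\,\sqrt{2pn},$$ with the right-hand side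 linearized up to the term of order $O(\varepsilon^2)$, i.e. $\|\widetilde U^{(\ell)}-U^{(\ell)}\|_2\le 14\,\varepsilon\,\ell\,\sqrt{2pn}+O(\varepsilon^2)$ as $\varepsilon\to 0$ for fixed $\ell,p,n$.
   Context: **Norm.** $\|\cdot\|_2$ is the spectral norm. **Exact transformations.** In stage $m$ of the parallel trigonometric Jacobi algorithm, $p$ pairwise disjoint pairs of column indices $(i,j)$, $i<j$, from $\{1,\dots,n\}$ are chosen, one pair per process, and each pair of columns is transformed by its own plane (trigonometric) rotation with real cosine $c$ and sine $s$, $c^2+s^2=1$: $$\bigl[u_i^{(m)},u_j^{(m)}\bigr]=\bigl[u_i^{(m-1)},u_j^{(m-1)}\bigr]\begin{bmatrix}c&s\\-s&c\end{bmatrix}.$$ Columns not belonging to any of the $p$ chosen pairs are unchanged. $Q^{(m)}\in\mathbb{R}^{n\times n}$ is the orthogonal matrix equal to the identity except that, for each chosen pair $(i,j)$, its $2\times2$ submatrix in rows and columns $i,j$ is $\begin{bmatrix}c&s\\-s&c\end{bmatrix}$ (with the $c,s$ of that pair). The pairs and the exact values $c,s$ may differ from stage to stage and from pair to pair. **Computed transformations.** $\widetilde Q^{(m)}$ is obtained from $Q^{(m)}$ by replacing each $c,s$ by the computed values $\tilde c=(1+\varepsilon_c)c$, $\tilde s=(1+\varepsilon_s)s$, where $\varepsilon_c,\varepsilon_s$ are the relative errors (which may differ for each rotation). **Floating-point model.** Each arithmetic operation $\circ\in\{+,-,\times,/\}$ satisfies $\mathrm{fl}(a\circ b)=(a\circ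 b)(1+\varepsilon_\circ)$ with $|\varepsilon_\circ|\le\varepsilon$. The matrix $\mathrm{fl}(\widetilde U^{(m-1)}\widetilde Q^{(m)})$ is computed by transforming only the chosen pairs of columns: for each chosen pair $(i,j)$ and each $k=1,\dots,n$, $$\tilde u_{ki}^{(m)}=\Bigl[(1+\varepsilon_1)\tilde c\,\tilde u_{ki}^{(m-1)}-(1+\varepsilon_2)\tilde s\,\tilde u_{kj}^{(m-1)}\Bigr](1+\varepsilon_3),$$ $$\tilde u_{kj}^{(m)}=\Bigl[(1+\varepsilon_4)\tilde s\,\tilde u_{ki}^{(m-1)}+(1+\varepsilon_5)\tilde c\,\tilde u_{kj}^{(m-1)}\Bigr](1+\varepsilon_6),$$ with some $|\varepsilon_1|,\dots,|\varepsilon_6|\le\varepsilon$ (depending on $k$, the pair and the stage). Columns not in any chosen pair are copied without error. *)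

theory Defs
  imports "HOL-Analysis.Analysis"
begin

(* The library norm on real^'n^'n is the Frobenius norm, so the operator norm induced by the
   Euclidean vector norm is named separately. *)
definition spectral_norm :: "real^'n^'m \<Rightarrow> real" where
  "spectral_norm A = onorm ((*v) A)"

definition touched :: "('n \<times> 'n) set \<Rightarrow> 'n \<Rightarrow> bool" where
  "touched P a \<longleftrightarrow> (\<exists>(i, j)\<in>P. a = i \<or> a = j)"

definition disjoint_pairs :: "nat \<Rightarrow> ('n::{finite,linorder} \<times> 'n) set \<Rightarrow> bool" where
  "disjoint_pairs p P \<longleftrightarrow> card P = p \<and> (\<forall>(i, j)\<in>P. i < j)
     \<and> pairwise (\<lambda>(i, j) (i', j'). {i, j} \<inter> {i', j'} = {}) P"

(* Entry $ a $ b is in row a and column b. The definite description picks out the unique pair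
   containing a; it is only used when a is touched. *)
definition rotation_matrix ::
  "('n \<times> 'n) set \<Rightarrow> ('n \<times> 'n \<Rightarrow> real) \<Rightarrow> ('n \<times> 'n \<Rightarrow> real) \<Rightarrow> real^'n^'n" where
  "rotation_matrix P c s = (\<chi> a b.
     if a = b then
       (if touched P a then c (THE q. q \<in> P \<and> (a = fst q \<or> a = snd q)) else 1)
     else if (a, b) \<in> P then s (a, b)
     else if (b, a) \<in> P then - s (b, a)
     else 0)"

lemma rotation_matrix_pair:
  assumes "disjoint_pairs p P" "(i, j) \<in> P"
  shows "rotation_matrix P c s $ i $ i = c (i, j)"
    and "rotation_matrix P c s $ i $ j = s (i, j)"
    and "rotation_matrix P c s $ j $ i = - s (i, j)"
    and "rotation_matrix P c s $ j $ j = c (i, j)"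
proof -
  have lt: "i < j" using assms by (auto simp: disjoint_pairs_def)
  have uniq: "q = (i, j)" if "q \<in> P" "x = fst q \<or> x = snd q" "x = i \<or> x = j" for q x
  proof (rule ccontr)
    assume "q \<noteq> (i, j)"
    moreover have "pairwise (\<lambda>(i, j) (i', j'). {i, j} \<inter> {i', j'} = {}) P"
      using assms(1) by (simp add: disjoint_pairs_def)
    ultimately have "(\<lambda>(i, j) (i', j'). {i, j} \<inter> {i', j'} = {}) q (i, j)"
      using assms(2) that(1) by (blast dest: pairwiseD)
    then have "{fst q, snd q} \<inter> {i, j} = {}"
      by (simp only: case_prod_beta fst_conv snd_conv)
    moreover have "x \<in> {fst q, snd q} \<inter> {i, j}"
      using that(2,3) by blast
    ultimately show False by blast
  qed
  have the_pair: "(THE q. q \<in> P \<and> (x = fst q \<or> x = snd q)) = (i, j)" if "x = i \<or> x = j" for x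
  proof (rule the_equality)
    show "(i, j) \<in> P \<and> (x = fst (i, j) \<or> x = snd (i, j))"
      using assms(2) that by simp
    show "q = (i, j)" if "q \<in> P \<and> (x = fst q \<or> x = snd q)" for q
      using that \<open>x = i \<or> x = j\<close> by (intro uniq[of q x]) blast+
  qed
  have tch: "touched P i" "touched P j"
    using assms(2) unfolding touched_def by blast+
  have "(j, i) \<notin> P"
    using assms(1) lt by (fastforce simp: disjoint_pairs_def)
  then show "rotation_matrix P c s $ i $ i = c (i, j)"
    and "rotation_matrix P c s $ i $ j = s (i, j)"
    and "rotation_matrix P c s $ j $ i = - s (i, j)"
    and "rotation_matrix P c s $ j $ j = c (i, j)"
    using assms(2) less_imp_neq[OF lt] not_sym[OF less_imp_neq[OF lt]] tch the_pair[of i] the_pair[of j] unfolding rotation_matrix_def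
    by simp_all
qed

(* W is a possible value of fl (V ** Q) with unit roundoff \<epsilon>, for Q a (computed) rotation matrix
   on the pairs P; its cosine and sine for the pair (i, j) are Q $ i $ i and Q $ i $ j. *)
definition fl_product ::
  "real \<Rightarrow> ('n \<times> 'n) set \<Rightarrow> real^'n^'n \<Rightarrow> real^'n^'n \<Rightarrow> real^'n^'n \<Rightarrow> bool" where
  "fl_product \<epsilon> P V Q W \<longleftrightarrow>
     (\<forall>(i, j)\<in>P. \<forall>k. \<exists>e1 e2 e3 e4 e5 e6.
        (\<forall>e\<in>{e1, e2, e3, e4, e5, e6}. \<bar>e\<bar> \<le> \<epsilon>) \<and>
        (let c = Q $ i $ i; s = Q $ i $ j in
           W $ k $ i = ((1 + e1) * c * V $ k $ i - (1 + e2) * s * V $ k $ j) * (1 + e3) \<and>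
           W $ k $ j = ((1 + e4) * s * V $ k $ i + (1 + e5) * c * V $ k $ j) * (1 + e6))) \<and>
     (\<forall>a k. \<not> touched P a \<longrightarrow> W $ k $ a = V $ k $ a)"

(* Data of one execution in exact and in floating-point arithmetic. The first argument of each
   field is the stage; stages are numbered from 1, and computed R 0 is the initial matrix. *)
record ('n::finite) jacobi_run =
  pairs :: "nat \<Rightarrow> ('n \<times> 'n) set"
  cosine :: "nat \<Rightarrow> 'n \<times> 'n \<Rightarrow> real"
  sine :: "nat \<Rightarrow> 'n \<times> 'n \<Rightarrow> real"
  cos_err :: "nat \<Rightarrow> 'n \<times> 'n \<Rightarrow> real"
  sin_err :: "nat \<Rightarrow> 'n \<times> 'n \<Rightarrow> real"
  computed :: "nat \<Rightarrow> real^'n^'n"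

definition exact_rotation :: "'n::finite jacobi_run \<Rightarrow> nat \<Rightarrow> real^'n^'n" where
  "exact_rotation R m = rotation_matrix (pairs R m) (cosine R m) (sine R m)"

definition computed_rotation :: "'n::finite jacobi_run \<Rightarrow> nat \<Rightarrow> real^'n^'n" where
  "computed_rotation R m = rotation_matrix (pairs R m)
     (\<lambda>q. (1 + cos_err R m q) * cosine R m q) (\<lambda>q. (1 + sin_err R m q) * sine R m q)"

primrec exact :: "'n::finite jacobi_run \<Rightarrow> nat \<Rightarrow> real^'n^'n" where
  "exact R 0 = mat 1"
| "exact R (Suc m) = exact R m ** exact_rotation R (Suc m)"

definition is_jacobi_run ::
  "real \<Rightarrow> nat \<Rightarrow> nat \<Rightarrow> 'n::{finite,linorder} jacobi_run \<Rightarrow> bool" where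
  "is_jacobi_run \<epsilon> p l R \<longleftrightarrow>
     computed R 0 = mat 1 \<and>
     (\<forall>m\<in>{1..l}.
        disjoint_pairs p (pairs R m) \<and>
        (\<forall>q\<in>pairs R m. (cosine R m q)\<^sup>2 + (sine R m q)\<^sup>2 = 1) \<and>
        fl_product \<epsilon> (pairs R m) (computed R (m - 1)) (computed_rotation R m) (computed R m))"

definition stage_perturbation :: "'n::finite jacobi_run \<Rightarrow> nat \<Rightarrow> real^'n^'n" where
  "stage_perturbation R m = computed R m - computed R (m - 1) ** exact_rotation R m"

definition accurate_rotations :: "real \<Rightarrow> nat \<Rightarrow> 'n::finite jacobi_run \<Rightarrow> bool" where
  "accurate_rotations \<epsilon> l R \<longleftrightarrow>
     (\<forall>m\<in>{1..l}. \<forall>q\<in>pairs R m.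
        \<bar>cos_err R m q\<bar> \<le> 5 * \<epsilon> / (1 - 5 * \<epsilon>) \<and> \<bar>sin_err R m q\<bar> \<le> 5 * \<epsilon> / (1 - 5 * \<epsilon>))"

end

theory Submission imports Defs begin

text \<open>
  Multiplication by an exact rotation preserves both the spectral and the Frobenius norm, so the
  stage perturbations simply add up. Each factor in a computed entry carries a relative error of
  \<open>7 \<epsilon> + O(\<epsilon>\<^sup>2) \<le> 8 \<epsilon>\<close>, hence an entry of the perturbation is at most \<open>8 \<epsilon>\<close> times the sum of
  the absolute values of the two entries it is computed from, and the Frobenius norm of the
  perturbation is at most \<open>16 \<epsilon>\<close> times that of the previous iterate. The latter is
  \<open>sqrt n + O(\<epsilon>)\<close>, and \<open>16 < 14 * sqrt 2\<close> leaves enough room to absorb all second-order terms.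
\<close>

section \<open>Spectral and Frobenius norms\<close>

lemma spectral_norm_0: "spectral_norm (0 :: real^'n^'m) = 0"
  unfolding spectral_norm_def
  by (subst onorm_eq_0[OF matrix_vector_mul_bounded_linear]) simp

lemma spectral_norm_triangle:
  "spectral_norm (A + B) \<le> spectral_norm A + spectral_norm (B :: real^'n^'m)"
  unfolding spectral_norm_def matrix_vector_mult_add_rdistrib
  by (intro onorm_triangle matrix_vector_mul_bounded_linear)

text \<open>Since \<open>Q *v x\<close> is as long as \<open>x\<close>, the operator bound for
  \<open>A\<close> at \<open>Q *v x\<close> is already the bound sought at \<open>x\<close>. This
  lets an accumulated error pass through an exact rotation without growing.\<close>

lemma spectral_norm_mult_isometry_le:
  fixes A :: "real^'n^'m" and Q :: "real^'k^'n"
  assumes "\<And>x. norm (Q *v x) = norm x"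
  shows "spectral_norm (A ** Q) \<le> spectral_norm A"
  unfolding spectral_norm_def
proof (rule onorm_le)
  show "norm ((A ** Q) *v x) \<le> onorm ((*v) A) * norm x" for x
    using onorm[OF matrix_vector_mul_bounded_linear, of A "Q *v x"]
    by (simp add: assms matrix_vector_mul_assoc)
qed

lemma norm_matrix_squared: "(norm (A :: real^'n^'m))\<^sup>2 = (\<Sum>i\<in>UNIV. \<Sum>j\<in>UNIV. (A $ i $ j)\<^sup>2)"
  by (simp add: norm_vec_def L2_set_def sum_nonneg)

text \<open>Cauchy-Schwarz is applied to each row of \<open>A\<close>, and the squares are summed.
  Rounding errors are known entrywise, so they are measured in the Frobenius norm and transferred by
  this comparison.\<close>

lemma spectral_norm_le_norm: "spectral_norm (A :: real^'n^'m) \<le> norm A"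
  unfolding spectral_norm_def
proof (rule onorm_le)
  fix x :: "real^'n"
  have "(norm (A *v x))\<^sup>2 = (\<Sum>i\<in>UNIV. (A $ i \<bullet> x)\<^sup>2)"
    by (simp add: norm_vec_def L2_set_def sum_nonneg matrix_vector_mul_component)
  also have "\<dots> \<le> (\<Sum>i\<in>UNIV. (norm (A $ i))\<^sup>2 * (norm x)\<^sup>2)"
    by (intro sum_mono) (simp add: Cauchy_Schwarz_ineq power2_norm_eq_inner)
  also have "\<dots> = (norm A * norm x)\<^sup>2"
    by (simp add: power_mult_distrib sum_distrib_right norm_vec_def[of A] L2_set_def sum_nonneg)
  finally show "norm (A *v x) \<le> norm A * norm x"
    by (rule power2_le_imp_le) simp
qed

section \<open>Sums over an involution of the index set\<close>

lemma sum_involution: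
  fixes f :: "'a::finite \<Rightarrow> real"
  assumes "\<And>a. \<sigma> (\<sigma> a) = a"
  shows "(\<Sum>a\<in>UNIV. f (\<sigma> a)) = (\<Sum>a\<in>UNIV. f a)"
  by (rule sum.reindex_bij_witness[of _ \<sigma> \<sigma>]) (use assms in auto)

text \<open>The cross term changes sign when reindexed by \<open>\<sigma>\<close>, because
  \<open>h\<close> is odd and \<open>g\<close> is even, so its sum equals its own negative and
  vanishes. Reindexing the squares of \<open>h a * x (\<sigma> a)\<close> then gathers the weight
  \<open>(g a)\<^sup>2 + (h a)\<^sup>2\<close> on each \<open>x a\<close>. Working with an
  involution avoids splitting the sum into pairs and remaining indices.\<close>

lemma sum_squares_rotation:
  fixes g h x :: "'a::finite \<Rightarrow> real"
  assumes inv: "\<And>a. \<sigma> (\<sigma> a) = a"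
    and g: "\<And>a. g (\<sigma> a) = g a" and h: "\<And>a. h (\<sigma> a) = - h a"
    and unit: "\<And>a. (g a)\<^sup>2 + (h a)\<^sup>2 = 1"
  shows "(\<Sum>a\<in>UNIV. (g a * x a + h a * x (\<sigma> a))\<^sup>2) = (\<Sum>a\<in>UNIV. (x a)\<^sup>2)"
proof -
  have "(\<Sum>a\<in>UNIV. g a * h a * x a * x (\<sigma> a)) = - (\<Sum>a\<in>UNIV. g a * h a * x a * x (\<sigma> a))"
    using sum_involution[of \<sigma> "\<lambda>a. g a * h a * x a * x (\<sigma> a)"]
    by (simp add: inv g h sum_negf mult_ac)
  moreover have "(\<Sum>a\<in>UNIV. (h a * x (\<sigma> a))\<^sup>2) = (\<Sum>a\<in>UNIV. (h a * x a)\<^sup>2)"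
    using sum_involution[of \<sigma> "\<lambda>a. (h a * x a)\<^sup>2"] by (simp add: inv h)
  moreover have "(\<Sum>a\<in>UNIV. (g a * x a + h a * x (\<sigma> a))\<^sup>2) =
      (\<Sum>a\<in>UNIV. (g a * x a)\<^sup>2) + (\<Sum>a\<in>UNIV. (h a * x (\<sigma> a))\<^sup>2)
        + 2 * (\<Sum>a\<in>UNIV. g a * h a * x a * x (\<sigma> a))"
    by (simp add: sum.distrib[symmetric] sum_distrib_left power2_sum mult_ac)
  ultimately have "(\<Sum>a\<in>UNIV. (g a * x a + h a * x (\<sigma> a))\<^sup>2) =
      (\<Sum>a\<in>UNIV. (g a * x a)\<^sup>2) + (\<Sum>a\<in>UNIV. (h a * x a)\<^sup>2)"
    by linarith
  also have "\<dots> = (\<Sum>a\<in>UNIV. ((g a)\<^sup>2 + (h a)\<^sup>2) * (x a)\<^sup>2)"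
    by (simp add: sum.distrib[symmetric] power_mult_distrib distrib_right)
  finally show ?thesis by (simp add: unit)
qed

text \<open>Fixing the untouched indices makes this a total involution for disjoint pairs, so whole
  rows can be reindexed at once.\<close>

definition partner :: "('n \<times> 'n) set \<Rightarrow> 'n \<Rightarrow> 'n" where
  "partner P a = (if touched P a then (THE b. (a, b) \<in> P \<or> (b, a) \<in> P) else a)"

section \<open>Disjoint pairs and the partner involution\<close>

context
  fixes p :: nat and P :: "('n::{finite,linorder} \<times> 'n) set"
  assumes P: "disjoint_pairs p P"
begin

lemma pair_unique:
  assumes "(i, j) \<in> P" "(i', j') \<in> P" "{i, j} \<inter> {i', j'} \<noteq> {}"
  shows "i' = i \<and> j' = j"
proof (rule ccontr)
  assume "\<not> (i' = i \<and> j' = j)"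
  then have "(i, j) \<noteq> (i', j')" by auto
  moreover have "pairwise (\<lambda>(i, j) (i', j'). {i, j} \<inter> {i', j'} = {}) P"
    using P by (simp add: disjoint_pairs_def)
  ultimately have "(\<lambda>(i, j) (i', j'). {i, j} \<inter> {i', j'} = {}) (i, j) (i', j')"
    using assms(1,2) by (blast dest: pairwiseD)
  then show False using assms(3) by (simp only: prod.case)
qed

lemma pair_less: "(i, j) \<in> P \<Longrightarrow> i < j"
  using P by (auto simp: disjoint_pairs_def)

lemma partner_pair:
  assumes "(i, j) \<in> P"
  shows "partner P i = j" "partner P j = i"
proof -
  have "touched P i" "touched P j"
    using assms unfolding touched_def by blast+
  moreover have "(THE b. (i, b) \<in> P \<or> (b, i) \<in> P) = j" "(THE b. (j, b) \<in> P \<or> (b, j) \<in> P) = i"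
    using assms pair_less[OF assms] by (auto intro!: the_equality dest: pair_unique[OF assms])
  ultimately show "partner P i = j" "partner P j = i"
    by (simp_all add: partner_def)
qed

lemma partner_cases:
  obtains (untouched) "\<not> touched P a" "partner P a = a"
  | (left) "(a, partner P a) \<in> P"
  | (right) "(partner P a, a) \<in> P"
proof (cases "touched P a")
  case True
  then obtain i j where "(i, j) \<in> P" "a = i \<or> a = j"
    unfolding touched_def by blast
  then show ?thesis
    using left right partner_pair by metis
qed (use untouched in \<open>simp add: partner_def\<close>)

lemma partner_partner: "partner P (partner P a) = a"
  by (cases a rule: partner_cases) (simp, (drule partner_pair, assumption)+)

section \<open>Entries of a rotation matrix, without any condition on \<open>c\<close> and
  \<open>s\<close>\<close>

context
  fixes c s :: "'n \<times> 'n \<Rightarrow> real"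
begin

private abbreviation "Q \<equiv> rotation_matrix P c s"

text \<open>The entry of column \<open>a\<close> outside the diagonal, with its sign. The value 0 at
  untouched indices matters: there \<open>partner P a = a\<close>, and the diagonal entry would
  otherwise be counted twice.\<close>

definition offdiag :: "'n \<Rightarrow> real" where
  "offdiag a = (if touched P a then Q $ partner P a $ a else 0)"

text \<open>A column is supported on \<open>a\<close> and its partner. Two added conditionals,
  rather than nested ones, let \<open>sum.delta\<close> evaluate matrix products without
  distinguishing touched from untouched columns.\<close>

lemma rotation_matrix_entry:
  "Q $ b $ a = (if b = a then Q $ a $ a else 0) + (if b = partner P a then offdiag a else 0)"
proof -
  have "Q $ b $ a = 0" if "b \<noteq> a" "b \<noteq> partner P a"
    using that partner_pair by (auto simp: rotation_matrix_def)
  moreover have "partner P a \<noteq> a" if "touched P a"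
    using that pair_less by (cases a rule: partner_cases) force+
  moreover have "partner P a = a" if "\<not> touched P a"
    using that by (simp add: partner_def)
  ultimately show ?thesis
    by (auto simp: offdiag_def)
qed

lemma diag_partner: "Q $ partner P a $ partner P a = Q $ a $ a"
proof (cases a rule: partner_cases)
  case left
  show ?thesis by (simp only: rotation_matrix_pair[OF P left])
next
  case right
  show ?thesis by (simp only: rotation_matrix_pair[OF P right])
qed simp

lemma untouched_entries:
  assumes "\<not> touched P a"
  shows "Q $ a $ a = 1" "offdiag a = 0"
  using assms by (simp_all add: offdiag_def rotation_matrix_def)

lemma offdiag_pair:
  assumes "(i, j) \<in> P"
  shows "offdiag i = - s (i, j)" "offdiag j = s (i, j)"
proof -
  have "touched P i" "touched P j"
    using assms unfolding touched_def by blast+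
  then show "offdiag i = - s (i, j)" "offdiag j = s (i, j)"
    by (simp_all only: offdiag_def partner_pair[OF assms] rotation_matrix_pair[OF P assms] if_True)
qed

lemma offdiag_partner: "offdiag (partner P a) = - offdiag a"
proof (cases a rule: partner_cases)
  case untouched
  then show ?thesis by (simp add: offdiag_def)
next
  case left
  show ?thesis by (simp add: offdiag_pair[OF left])
next
  case right
  show ?thesis by (simp add: offdiag_pair[OF right])
qed

lemma mult_rotation_matrix_entry:
  "(V ** Q) $ k $ a = Q $ a $ a * V $ k $ a + offdiag a * V $ k $ partner P a"
proof -
  have "(V ** Q) $ k $ a = (\<Sum>b\<in>UNIV. V $ k $ b * Q $ b $ a)"
    by (simp add: matrix_matrix_mult_def)
  also have "\<dots> = (\<Sum>b\<in>UNIV. (if b = a then Q $ a $ a * V $ k $ b else 0)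
      + (if b = partner P a then offdiag a * V $ k $ b else 0))"
    by (intro sum.cong refl, subst rotation_matrix_entry) (simp add: distrib_left)
  finally show ?thesis
    by (simp only: sum.distrib sum.delta finite UNIV_I if_True)
qed

text \<open>The minus sign appears because row \<open>a\<close> meets column
  \<open>partner P a\<close>, whose off-diagonal entry is \<open>- offdiag a\<close>.\<close>

lemma rotation_matrix_vector_entry:
  "(Q *v x) $ a = Q $ a $ a * x $ a - offdiag a * x $ partner P a"
proof -
  have "(Q *v x) $ a = (\<Sum>b\<in>UNIV. Q $ a $ b * x $ b)"
    by (simp add: matrix_vector_mult_def)
  also have "\<dots> = (\<Sum>b\<in>UNIV. (if b = a then Q $ a $ a * x $ b else 0)
      + (if b = partner P a then - offdiag a * x $ b else 0))"
  proof (intro sum.cong refl)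
    fix b
    have "a = partner P b \<longleftrightarrow> b = partner P a"
      using partner_partner by metis
    then show "Q $ a $ b * x $ b = (if b = a then Q $ a $ a * x $ b else 0)
        + (if b = partner P a then - offdiag a * x $ b else 0)"
      by (subst rotation_matrix_entry) (auto simp: offdiag_partner distrib_right)
  qed
  finally show ?thesis
    by (simp only: sum.distrib sum.delta finite UNIV_I if_True)
qed

section \<open>Norm preservation by exact rotations\<close>

context
  assumes unit: "\<And>q. q \<in> P \<Longrightarrow> (c q)\<^sup>2 + (s q)\<^sup>2 = 1"
begin

lemma diag_offdiag_unit: "(Q $ a $ a)\<^sup>2 + (offdiag a)\<^sup>2 = 1"
proof (cases a rule: partner_cases)
  case untouched
  then show ?thesis by (simp add: untouched_entries)
next
  case left
  show ?thesis
    by (simp only: offdiag_pair[OF left] rotation_matrix_pair[OF P left] power2_minus unit[OF left])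
next
  case right
  show ?thesis
    by (simp only: offdiag_pair[OF right] rotation_matrix_pair[OF P right] unit[OF right])
qed

text \<open>Each row of \<open>V\<close> is rotated separately, so
  \<open>sum_squares_rotation\<close> applies row by row. This controls the Frobenius norm of the
  computed iterates.\<close>

lemma norm_mult_rotation_matrix: "norm ((V :: real^('n::{finite,linorder})^'m) ** Q) = norm V"
proof -
  have "(\<Sum>a\<in>UNIV. (Q $ a $ a * V $ k $ a + offdiag a * V $ k $ partner P a)\<^sup>2)
      = (\<Sum>a\<in>UNIV. (V $ k $ a)\<^sup>2)" for k
    by (rule sum_squares_rotation[where \<sigma> = "partner P" and g = "\<lambda>a. Q $ a $ a" and h = offdiag
          and x = "\<lambda>a. V $ k $ a"])
      (rule partner_partner diag_partner offdiag_partner diag_offdiag_unit)+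
  then have "(norm (V ** Q))\<^sup>2 = (norm V)\<^sup>2"
    by (simp only: norm_matrix_squared mult_rotation_matrix_entry)
  then show ?thesis by simp
qed

text \<open>The same argument with \<open>- offdiag\<close>, which is odd under
  \<open>partner P\<close> as well. It supplies the isometry hypothesis of
  \<open>spectral_norm_mult_isometry_le\<close>.\<close>

lemma norm_rotation_matrix_vector: "norm (Q *v x) = norm x"
proof -
  have "(\<Sum>a\<in>UNIV. (Q $ a $ a * x $ a + (- offdiag a) * x $ partner P a)\<^sup>2) = (\<Sum>a\<in>UNIV. (x $ a)\<^sup>2)"
  proof (rule sum_squares_rotation[where \<sigma> = "partner P" and g = "\<lambda>a. Q $ a $ a"
        and h = "\<lambda>a. - offdiag a" and x = "\<lambda>a. x $ a", OF partner_partner diag_partner])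
    show "- offdiag (partner P a) = - (- offdiag a)" for a
      by (simp only: offdiag_partner)
    show "(Q $ a $ a)\<^sup>2 + (- offdiag a)\<^sup>2 = 1" for a
      by (simp only: power2_minus diag_offdiag_unit)
  qed
  then show ?thesis
    by (simp add: norm_vec_def L2_set_def rotation_matrix_vector_entry)
qed

end

end

end

section \<open>Rounding error of a single stage\<close>

lemma relative_error_bound:
  fixes \<epsilon> :: real
  assumes "\<epsilon> \<le> 1 / 100" "\<bar>e\<bar> \<le> \<epsilon>" "\<bar>f\<bar> \<le> \<epsilon>" "\<bar>d\<bar> \<le> 5 * \<epsilon> / (1 - 5 * \<epsilon>)"
  shows "\<bar>(1 + e) * (1 + d) * (1 + f) - 1\<bar> \<le> 8 * \<epsilon>"
proof -
  have "0 \<le> \<epsilon>" using assms(2) by linarith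
  \<comment> \<open>Here \<open>1 - 5 * \<epsilon>\<close> is at least 95/100, and 5 / 0.95 is below
    11/2.\<close>
  then have "5 * \<epsilon> / (1 - 5 * \<epsilon>) \<le> 11 / 2 * \<epsilon>"
    using assms(1) mult_left_mono[OF assms(1), of \<epsilon>] by (simp add: field_simps)
  then have d: "\<bar>d\<bar> \<le> 11 / 2 * \<epsilon>" using assms(4) by linarith
  have "\<bar>e * f\<bar> \<le> \<epsilon> * (1 / 100)" "\<bar>e * d\<bar> \<le> 1 / 100 * (11 / 2 * \<epsilon>)" "\<bar>d * f\<bar> \<le> 11 / 2 * \<epsilon> * (1 / 100)"
    unfolding abs_mult using assms d \<open>0 \<le> \<epsilon>\<close> by (intro mult_mono; linarith)+
  moreover have "\<bar>(e * d) * f\<bar> \<le> 1 / 100 * (11 / 2 * \<epsilon>) * 1"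
    unfolding abs_mult[of "e * d" f] using assms \<open>0 \<le> \<epsilon>\<close> calculation(2) by (intro mult_mono; linarith)
  moreover have "(1 + e) * (1 + d) * (1 + f) - 1 = e + d + f + e * f + e * d + d * f + (e * d) * f"
    by (simp add: algebra_simps)
  \<comment> \<open>In units of \<open>\<epsilon>\<close>, the linear terms give at most 1 + 1 + 5.5
    and the remaining four at most 0.01 + 3 * 0.055, in total less than 8.\<close>
  ultimately show ?thesis using assms(2,3) d \<open>0 \<le> \<epsilon>\<close> by linarith
qed

text \<open>The difference is \<open>(t - 1) * g * x + (u - 1) * h * y\<close>. For \<open>g\<close>
  and \<open>h\<close> a cosine and a signed sine, the bounds by 1 hold.\<close>

lemma perturbed_combination_bound:
  fixes x y :: real
  assumes "\<bar>t - 1\<bar> \<le> \<mu>" "\<bar>u - 1\<bar> \<le> \<mu>" "\<bar>g\<bar> \<le> 1" "\<bar>h\<bar> \<le> 1"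
  shows "\<bar>(t * g * x + u * h * y) - (g * x + h * y)\<bar> \<le> \<mu> * (\<bar>x\<bar> + \<bar>y\<bar>)"
proof -
  have "\<bar>(t - 1) * g\<bar> \<le> \<mu> * 1" "\<bar>(u - 1) * h\<bar> \<le> \<mu> * 1"
    unfolding abs_mult using assms by (intro mult_mono; linarith)+
  then have "\<bar>(t - 1) * g * x\<bar> \<le> \<mu> * \<bar>x\<bar>" "\<bar>(u - 1) * h * y\<bar> \<le> \<mu> * \<bar>y\<bar>"
    unfolding abs_mult[of _ x] abs_mult[of _ y] by (intro mult_right_mono; simp)+
  then show ?thesis by (simp add: algebra_simps)
qed


text \<open>Each of the two products in a computed entry carries three relative errors: that of the
  cosine or sine, that of the multiplication, and that of the final addition or subtraction.
  Untouched columns are copied, so their error is 0.\<close>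

lemma fl_product_entry_error:
  fixes P :: "('n::{finite,linorder} \<times> 'n) set" and c s d d' :: "'n \<times> 'n \<Rightarrow> real"
  defines "Q \<equiv> rotation_matrix P c s"
  assumes P: "disjoint_pairs p P"
    and unit: "\<And>q. q \<in> P \<Longrightarrow> (c q)\<^sup>2 + (s q)\<^sup>2 = 1"
    and \<epsilon>: "0 \<le> \<epsilon>" "\<epsilon> \<le> 1 / 100"
    and d: "\<And>q. q \<in> P \<Longrightarrow> \<bar>d q\<bar> \<le> 5 * \<epsilon> / (1 - 5 * \<epsilon>)"
    and d': "\<And>q. q \<in> P \<Longrightarrow> \<bar>d' q\<bar> \<le> 5 * \<epsilon> / (1 - 5 * \<epsilon>)"
    and fl: "fl_product \<epsilon> P V (rotation_matrix P (\<lambda>q. (1 + d q) * c q) (\<lambda>q. (1 + d' q) * s q)) W"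
  shows "\<bar>W $ k $ a - (V ** Q) $ k $ a\<bar> \<le> 8 * \<epsilon> * (\<bar>V $ k $ a\<bar> + \<bar>V $ k $ partner P a\<bar>)"
proof -
  have pair: "\<bar>W $ k $ i - (V ** Q) $ k $ i\<bar> \<le> 8 * \<epsilon> * (\<bar>V $ k $ i\<bar> + \<bar>V $ k $ j\<bar>) \<and>
      \<bar>W $ k $ j - (V ** Q) $ k $ j\<bar> \<le> 8 * \<epsilon> * (\<bar>V $ k $ j\<bar> + \<bar>V $ k $ i\<bar>)" if ij: "(i, j) \<in> P" for i j
  proof -
    note rot = rotation_matrix_pair[OF P ij]
    have "\<exists>e1 e2 e3 e4 e5 e6. (\<forall>e\<in>{e1, e2, e3, e4, e5, e6}. \<bar>e\<bar> \<le> \<epsilon>) \<and>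
        W $ k $ i = ((1 + e1) * ((1 + d (i, j)) * c (i, j)) * V $ k $ i
          - (1 + e2) * ((1 + d' (i, j)) * s (i, j)) * V $ k $ j) * (1 + e3) \<and>
        W $ k $ j = ((1 + e4) * ((1 + d' (i, j)) * s (i, j)) * V $ k $ i
          + (1 + e5) * ((1 + d (i, j)) * c (i, j)) * V $ k $ j) * (1 + e6)"
      using bspec[OF conjunct1[OF fl[unfolded fl_product_def]] ij] by (simp only: prod.case Let_def rot)
    then obtain e1 e2 e3 e4 e5 e6 where e: "\<forall>e\<in>{e1, e2, e3, e4, e5, e6}. \<bar>e\<bar> \<le> \<epsilon>"
      and W: "W $ k $ i = ((1 + e1) * ((1 + d (i, j)) * c (i, j)) * V $ k $ i
          - (1 + e2) * ((1 + d' (i, j)) * s (i, j)) * V $ k $ j) * (1 + e3)"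
        "W $ k $ j = ((1 + e4) * ((1 + d' (i, j)) * s (i, j)) * V $ k $ i
          + (1 + e5) * ((1 + d (i, j)) * c (i, j)) * V $ k $ j) * (1 + e6)"
      by (elim exE conjE) (rule that; assumption)
    \<comment> \<open>The last rounding factor is distributed over both products, and the entry's
      own column is put first, so that both columns match
      \<open>perturbed_combination_bound\<close>. The sign of the sine is moved into the
      coefficient.\<close>
    have Wi: "W $ k $ i = ((1 + e1) * (1 + d (i, j)) * (1 + e3)) * c (i, j) * V $ k $ i
          + ((1 + e2) * (1 + d' (i, j)) * (1 + e3)) * (- s (i, j)) * V $ k $ j"
      and Wj: "W $ k $ j = ((1 + e5) * (1 + d (i, j)) * (1 + e6)) * c (i, j) * V $ k $ j
          + ((1 + e4) * (1 + d' (i, j)) * (1 + e6)) * s (i, j) * V $ k $ i"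
      unfolding W by algebra+
    have "(c (i, j))\<^sup>2 \<le> 1" "(s (i, j))\<^sup>2 \<le> 1"
      using unit[OF ij] zero_le_power2[of "c (i, j)"] zero_le_power2[of "s (i, j)"] by linarith+
    then have cs: "\<bar>c (i, j)\<bar> \<le> 1" "\<bar>- s (i, j)\<bar> \<le> 1" "\<bar>s (i, j)\<bar> \<le> 1"
      by (simp_all add: abs_square_le_1)
    have Qi: "(V ** Q) $ k $ i = c (i, j) * V $ k $ i + (- s (i, j)) * V $ k $ j"
      and Qj: "(V ** Q) $ k $ j = c (i, j) * V $ k $ j + s (i, j) * V $ k $ i"
      unfolding Q_def mult_rotation_matrix_entry[OF P]
      by (simp_all only: offdiag_pair[OF P ij] partner_pair[OF P ij] rot)
    have "\<bar>W $ k $ i - (V ** Q) $ k $ i\<bar> \<le> 8 * \<epsilon> * (\<bar>V $ k $ i\<bar> + \<bar>V $ k $ j\<bar>)"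
      unfolding Wi Qi using e d[OF ij] d'[OF ij] \<epsilon>(2) cs
      by (intro perturbed_combination_bound relative_error_bound) auto
    moreover have "\<bar>W $ k $ j - (V ** Q) $ k $ j\<bar> \<le> 8 * \<epsilon> * (\<bar>V $ k $ j\<bar> + \<bar>V $ k $ i\<bar>)"
      unfolding Wj Qj using e d[OF ij] d'[OF ij] \<epsilon>(2) cs
      by (intro perturbed_combination_bound relative_error_bound) auto
    ultimately show ?thesis by blast
  qed
  show ?thesis
  proof (cases a rule: partner_cases[OF P, case_names untouched left right])
    case untouched
    then have "W $ k $ a = V $ k $ a"
      using conjunct2[OF fl[unfolded fl_product_def]] by blast
    also have "\<dots> = (V ** Q) $ k $ a"
      unfolding Q_def mult_rotation_matrix_entry[OF P] untouched_entries[OF P untouched(1)] by simp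
    finally show ?thesis using \<epsilon>(1) by simp
  qed (use pair in blast)+
qed

text \<open>Squaring the entry bound and using
  \<open>(x + y)\<^sup>2 \<le> 2 * (x\<^sup>2 + y\<^sup>2)\<close> gives the factor 2 * 64 = 128.
  Summing over the partners repeats the sum over all columns, which doubles it to 256, the square of
  16.\<close>

lemma fl_product_norm_error:
  fixes P :: "('n::{finite,linorder} \<times> 'n) set" and c s d d' :: "'n \<times> 'n \<Rightarrow> real"
  assumes P: "disjoint_pairs p P"
    and "\<And>q. q \<in> P \<Longrightarrow> (c q)\<^sup>2 + (s q)\<^sup>2 = 1"
    and \<epsilon>: "0 \<le> \<epsilon>" "\<epsilon> \<le> 1 / 100"
    and "\<And>q. q \<in> P \<Longrightarrow> \<bar>d q\<bar> \<le> 5 * \<epsilon> / (1 - 5 * \<epsilon>)"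
    and "\<And>q. q \<in> P \<Longrightarrow> \<bar>d' q\<bar> \<le> 5 * \<epsilon> / (1 - 5 * \<epsilon>)"
    and "fl_product \<epsilon> P V (rotation_matrix P (\<lambda>q. (1 + d q) * c q) (\<lambda>q. (1 + d' q) * s q)) W"
  shows "norm (W - V ** rotation_matrix P c s) \<le> 16 * \<epsilon> * norm V"
proof -
  let ?Q = "rotation_matrix P c s"
  have "((W - V ** ?Q) $ k $ a)\<^sup>2 \<le> 128 * \<epsilon>\<^sup>2 * ((V $ k $ a)\<^sup>2 + (V $ k $ partner P a)\<^sup>2)" for k a
  proof -
    have "((W - V ** ?Q) $ k $ a)\<^sup>2 \<le> (8 * \<epsilon> * (\<bar>V $ k $ a\<bar> + \<bar>V $ k $ partner P a\<bar>))\<^sup>2"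
      unfolding vector_minus_component
      using fl_product_entry_error[OF assms] by (rule power2_le_iff_abs_le[THEN iffD2, rotated]) (use \<epsilon> in \<open>auto intro!: mult_nonneg_nonneg\<close>)
    also have "\<dots> = 64 * \<epsilon>\<^sup>2 * (\<bar>V $ k $ a\<bar> + \<bar>V $ k $ partner P a\<bar>)\<^sup>2"
      by (simp add: power_mult_distrib)
    also have "\<dots> \<le> 64 * \<epsilon>\<^sup>2 * (2 * ((V $ k $ a)\<^sup>2 + (V $ k $ partner P a)\<^sup>2))"
      using sum_squares_bound[of "\<bar>V $ k $ a\<bar>" "\<bar>V $ k $ partner P a\<bar>"]
      by (intro mult_left_mono) (simp_all add: power2_sum)
    finally show ?thesis by (simp only: mult.assoc[symmetric])
  qed
  then have "(norm (W - V ** ?Q))\<^sup>2 \<le>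
      (\<Sum>k\<in>UNIV. \<Sum>a\<in>UNIV. 128 * \<epsilon>\<^sup>2 * ((V $ k $ a)\<^sup>2 + (V $ k $ partner P a)\<^sup>2))"
    unfolding norm_matrix_squared by (intro sum_mono)
  also have "\<dots> = 128 * \<epsilon>\<^sup>2 * (\<Sum>k\<in>UNIV. (\<Sum>a\<in>UNIV. (V $ k $ a)\<^sup>2) + (\<Sum>a\<in>UNIV. (V $ k $ partner P a)\<^sup>2))"
    by (simp only: sum_distrib_left[symmetric] sum.distrib)
  also have "\<dots> = 128 * \<epsilon>\<^sup>2 * (\<Sum>k\<in>UNIV. (\<Sum>a\<in>UNIV. (V $ k $ a)\<^sup>2) + (\<Sum>a\<in>UNIV. (V $ k $ a)\<^sup>2))"
    by (simp only: sum_involution[where f = "\<lambda>a. (V $ k $ a)\<^sup>2" for k, OF partner_partner[OF P]])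
  also have "\<dots> = (16 * \<epsilon> * norm V)\<^sup>2"
    by (simp add: power_mult_distrib norm_matrix_squared sum_distrib_left mult.assoc)
  finally show ?thesis
    by (rule power2_le_imp_le) (use \<epsilon> in simp)
qed

section \<open>Accumulation of the errors over the stages\<close>

lemma is_jacobi_run_stage:
  assumes "is_jacobi_run \<epsilon> p l R" "m < l"
  shows "disjoint_pairs p (pairs R (Suc m))"
    and "\<And>q. q \<in> pairs R (Suc m) \<Longrightarrow> (cosine R (Suc m) q)\<^sup>2 + (sine R (Suc m) q)\<^sup>2 = 1"
    and "fl_product \<epsilon> (pairs R (Suc m)) (computed R m) (computed_rotation R (Suc m)) (computed R (Suc m))"
proof -
  have "Suc m \<in> {1..l}" using assms(2) by simp
  then show "disjoint_pairs p (pairs R (Suc m))"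
    and "\<And>q. q \<in> pairs R (Suc m) \<Longrightarrow> (cosine R (Suc m) q)\<^sup>2 + (sine R (Suc m) q)\<^sup>2 = 1"
    and "fl_product \<epsilon> (pairs R (Suc m)) (computed R m) (computed_rotation R (Suc m)) (computed R (Suc m))"
    using assms(1) unfolding is_jacobi_run_def by force+
qed

lemma computed_Suc:
  "computed R (Suc m) = computed R m ** exact_rotation R (Suc m) + stage_perturbation R (Suc m)"
  by (simp add: stage_perturbation_def)

text \<open>The error after a stage is the previous error times the exact rotation, plus the stage
  perturbation; the rotation does not increase the spectral norm. The induction runs over
  \<open>k\<close> with \<open>l\<close> fixed, so that the hypothesis on the run stays
  unchanged.\<close>

lemma spectral_error_le_sum:
  assumes "is_jacobi_run \<epsilon> p l R" "k \<le> l"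
  shows "spectral_norm (computed R k - exact R k) \<le> (\<Sum>m=1..k. spectral_norm (stage_perturbation R m))"
  using assms(2)
proof (induction k)
  case 0
  then show ?case
    using assms(1) by (simp add: is_jacobi_run_def spectral_norm_0)
next
  case (Suc k)
  note stage = is_jacobi_run_stage[OF assms(1), of k]
  have "computed R (Suc k) - exact R (Suc k) =
      (computed R k - exact R k) ** exact_rotation R (Suc k) + stage_perturbation R (Suc k)"
    by (simp add: computed_Suc vec_eq_iff matrix_matrix_mult_def left_diff_distrib sum_subtractf)
  then have "spectral_norm (computed R (Suc k) - exact R (Suc k)) \<le>
      spectral_norm ((computed R k - exact R k) ** exact_rotation R (Suc k))
        + spectral_norm (stage_perturbation R (Suc k))"
    by (simp add: spectral_norm_triangle)
  also have "spectral_norm ((computed R k - exact R k) ** exact_rotation R (Suc k)) \<le>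
      spectral_norm (computed R k - exact R k)"
    using Suc.prems stage unfolding exact_rotation_def
    by (intro spectral_norm_mult_isometry_le norm_rotation_matrix_vector) auto
  finally show ?case using Suc by simp
qed

lemma stage_perturbation_norm_le:
  assumes "is_jacobi_run \<epsilon> p l R" "accurate_rotations \<epsilon> l R" "0 \<le> \<epsilon>" "\<epsilon> \<le> 1 / 100" "m < l"
  shows "norm (stage_perturbation R (Suc m)) \<le> 16 * \<epsilon> * norm (computed R m)"
proof -
  have "\<bar>cos_err R (Suc m) q\<bar> \<le> 5 * \<epsilon> / (1 - 5 * \<epsilon>)" "\<bar>sin_err R (Suc m) q\<bar> \<le> 5 * \<epsilon> / (1 - 5 * \<epsilon>)"
    if "q \<in> pairs R (Suc m)" for q
    using assms(2,5) that by (auto simp: accurate_rotations_def)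
  then show ?thesis
    using is_jacobi_run_stage[OF assms(1,5)] assms(3,4)
    unfolding stage_perturbation_def exact_rotation_def computed_rotation_def diff_Suc_1
    by (intro fl_product_norm_error[where d = "cos_err R (Suc m)" and d' = "sin_err R (Suc m)"]) auto
qed

lemma norm_mat_1: "norm (mat 1 :: real^'n^'n) = sqrt (real CARD('n))"
proof -
  have "(norm (mat 1 :: real^'n^'n))\<^sup>2 = real CARD('n)"
    unfolding norm_matrix_squared by (simp add: mat_def if_distrib[of "\<lambda>x. x\<^sup>2"] cong: if_cong)
  then show ?thesis by (metis norm_ge_zero real_sqrt_unique)
qed

text \<open>The iterates lose orthogonality, but the exact rotation keeps the norm and the
  perturbation adds at most \<open>16 * \<epsilon>\<close> times it, so each stage costs a factor
  \<open>1 + 16 * \<epsilon>\<close>.\<close>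

lemma computed_norm_le:
  fixes R :: "'n::{finite,linorder} jacobi_run"
  assumes run: "is_jacobi_run \<epsilon> p l R" and \<epsilon>: "accurate_rotations \<epsilon> l R" "0 \<le> \<epsilon>" "\<epsilon> \<le> 1 / 100"
    and "m \<le> l"
  shows "norm (computed R m) \<le> (1 + 16 * \<epsilon>) ^ m * sqrt (real CARD('n))"
  using \<open>m \<le> l\<close>
proof (induction m)
  case 0
  then show ?case using run by (simp add: is_jacobi_run_def norm_mat_1)
next
  case (Suc m)
  then have "m < l" by simp
  have "norm (computed R (Suc m)) \<le>
      norm (computed R m ** exact_rotation R (Suc m)) + norm (stage_perturbation R (Suc m))"
    unfolding computed_Suc by (rule norm_triangle_ineq)
  also have "\<dots> \<le> norm (computed R m) + 16 * \<epsilon> * norm (computed R m)"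
  proof (rule add_mono)
    show "norm (computed R m ** exact_rotation R (Suc m)) \<le> norm (computed R m)"
      unfolding exact_rotation_def using is_jacobi_run_stage(1,2)[OF run \<open>m < l\<close>]
      by (intro eq_refl norm_mult_rotation_matrix) auto
  qed (rule stage_perturbation_norm_le[OF run \<epsilon> \<open>m < l\<close>])
  also have "\<dots> = (1 + 16 * \<epsilon>) * norm (computed R m)"
    by (simp add: algebra_simps)
  also have "\<dots> \<le> (1 + 16 * \<epsilon>) * ((1 + 16 * \<epsilon>) ^ m * sqrt (real CARD('n)))"
    using Suc \<epsilon>(2) by (intro mult_left_mono) auto
  finally show ?case by (simp add: mult_ac)
qed

text \<open>The growth bound 6/5 leaves each stage with the constant 16 * 6/5 = 96/5, which is below
  14 * 7/5 = 98/5, while 7/5 is below the square root of 2.\<close>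

lemma spectral_error_le:
  fixes R :: "'n::{finite,linorder} jacobi_run"
  assumes run: "is_jacobi_run \<epsilon> p l R" and \<epsilon>: "accurate_rotations \<epsilon> l R" "0 \<le> \<epsilon>" "\<epsilon> \<le> 1 / 100"
    and growth: "(1 + 16 * \<epsilon>) ^ l \<le> 6 / 5" and "1 \<le> p"
  shows "spectral_norm (computed R l - exact R l) \<le> 14 * \<epsilon> * real l * sqrt (2 * real p * real CARD('n))"
proof -
  let ?n = "real CARD('n)"
  have stage: "spectral_norm (stage_perturbation R m) \<le> 16 * \<epsilon> * (6 / 5 * sqrt ?n)" if m: "m \<in> {1..l}" for m
  proof -
    obtain k where k: "m = Suc k" "k < l" using m by (cases m) auto
    have "norm (computed R k) \<le> (1 + 16 * \<epsilon>) ^ k * sqrt ?n"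
      using computed_norm_le[OF run \<epsilon>] k by simp
    also have "(1 + 16 * \<epsilon>) ^ k \<le> (1 + 16 * \<epsilon>) ^ l"
      using \<epsilon>(2) k by (intro power_increasing) auto
    finally have "norm (computed R k) \<le> 6 / 5 * sqrt ?n"
      using growth by (smt (verit) mult_right_mono real_sqrt_ge_zero of_nat_0_le_iff)
    then have "16 * \<epsilon> * norm (computed R k) \<le> 16 * \<epsilon> * (6 / 5 * sqrt ?n)"
      using \<epsilon>(2) by (intro mult_left_mono) auto
    then show ?thesis
      using stage_perturbation_norm_le[OF run \<epsilon> k(2)] spectral_norm_le_norm[of "stage_perturbation R m"]
      unfolding k(1) by linarith
  qed
  \<comment> \<open>A rational lower bound for the square root of 2: 49/25 is at most 2, hence at
    most \<open>2 * real p\<close>.\<close>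
  have "sqrt ((7 / 5)\<^sup>2 * ?n) \<le> sqrt (2 * real p * ?n)"
    using \<open>1 \<le> p\<close> by (intro real_sqrt_le_mono mult_right_mono) (auto simp: power2_eq_square)
  then have "7 / 5 * sqrt ?n \<le> sqrt (2 * real p * ?n)"
    by (simp only: real_sqrt_mult real_sqrt_abs)
  then have sqrt_le: "96 / 5 * sqrt ?n \<le> 14 * sqrt (2 * real p * ?n)"
    using real_sqrt_ge_zero[of ?n] by linarith
  have "spectral_norm (computed R l - exact R l) \<le> (\<Sum>m=1..l. spectral_norm (stage_perturbation R m))"
    using run by (rule spectral_error_le_sum) simp
  also have "\<dots> \<le> (\<Sum>m=1..l. 16 * \<epsilon> * (6 / 5 * sqrt ?n))"
    using stage by (rule sum_mono)
  also have "\<dots> = \<epsilon> * real l * (96 / 5 * sqrt ?n)"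
    by simp
  also have "\<dots> \<le> \<epsilon> * real l * (14 * sqrt (2 * real p * ?n))"
    using sqrt_le \<epsilon>(2) by (intro mult_left_mono) auto
  finally show ?thesis by (simp add: mult_ac)
qed

theorem theorem1:
  fixes p l :: nat
  assumes "1 \<le> p" and "2 * p \<le> CARD('n::{finite,linorder})"
  shows "(\<forall>\<epsilon>>0. \<forall>R :: 'n jacobi_run. is_jacobi_run \<epsilon> p l R \<longrightarrow>
            spectral_norm (computed R l - exact R l)
              \<le> (\<Sum>m=1..l. spectral_norm (stage_perturbation R m)))
       \<and> (\<exists>C. \<forall>\<^sub>F \<epsilon> in at_right 0. \<forall>R :: 'n jacobi_run.
            is_jacobi_run \<epsilon> p l R \<and> accurate_rotations \<epsilon> l R \<longrightarrow>
            spectral_norm (computed R l - exact R l)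
              \<le> 14 * \<epsilon> * real l * sqrt (2 * real p * real CARD('n)) + C * \<epsilon>\<^sup>2)"
\<comment> \<open>The witness for \<open>C\<close> is 0: for small \<open>\<epsilon>\<close> the
  second-order terms fit into the slack of the leading constant.\<close>
proof (intro conjI allI impI exI[of _ 0])
  show "spectral_norm (computed R l - exact R l) \<le> (\<Sum>m=1..l. spectral_norm (stage_perturbation R m))"
    if "is_jacobi_run \<epsilon> p l R" for \<epsilon> and R :: "'n jacobi_run"
    using that by (rule spectral_error_le_sum) simp
  \<comment> \<open>For fixed \<open>l\<close> the growth factor tends to 1, hence is eventually
    below 6/5; how small \<open>\<epsilon>\<close> must be depends on \<open>l\<close>.\<close>
  have "((\<lambda>\<epsilon>. (1 + 16 * \<epsilon>) ^ l) \<longlongrightarrow> (1 + 16 * 0) ^ l) (at_right (0 :: real))"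
    by (intro tendsto_intros)
  then have "\<forall>\<^sub>F \<epsilon> in at_right (0 :: real). (1 + 16 * \<epsilon>) ^ l < 6 / 5"
    by (rule order_tendstoD) simp
  moreover have "\<forall>\<^sub>F \<epsilon> in at_right (0 :: real). \<epsilon> < 1 / 100"
    by (rule eventually_at_right_real[of 0 "1 / 100", THEN eventually_mono]) auto
  moreover have "\<forall>\<^sub>F \<epsilon> in at_right (0 :: real). 0 < \<epsilon>"
    by (rule eventually_at_right_less)
  ultimately show "\<forall>\<^sub>F \<epsilon> in at_right 0. \<forall>R :: 'n jacobi_run.
      is_jacobi_run \<epsilon> p l R \<and> accurate_rotations \<epsilon> l R \<longrightarrow>
      spectral_norm (computed R l - exact R l)
        \<le> 14 * \<epsilon> * real l * sqrt (2 * real p * real CARD('n)) + 0 * \<epsilon>\<^sup>2"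
  proof eventually_elim
    case (elim \<epsilon>)
    then have "spectral_norm (computed R l - exact R l) \<le> 14 * \<epsilon> * real l * sqrt (2 * real p * real CARD('n))"
      if "is_jacobi_run \<epsilon> p l R" "accurate_rotations \<epsilon> l R" for R :: "'n jacobi_run"
      using that \<open>1 \<le> p\<close> by (intro spectral_error_le) auto
    then show ?case by simp
  qed
qed

end
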